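(* Let $v\colon[0,1)\to(0,\infty)$ be a weight function and let $g\in H(\mathbb{D})$ be non-constant. (i) The operator $V_g\colon H^\infty_v\to H^\infty_v$ is continuous (i.e. $V_g$ maps $H^\infty_v$ into itself and is continuous there) if and only if the operator $T_g\colon H^\infty_v\to H^\infty_v$ is continuous. (ii) Let $V_g\colon H^\infty_v\to H^\infty_v$ be continuous. Then $[V_g,H^\infty_v]=[T_g,H^\infty_v]$ as linear spaces in $H(\mathbb{D})$ and with equivalent norms. (iii) The operator $V_g\colon H^0_v\to H^0_v$ is continuous (i.e. $V_g$ maps $H^0_v$ into itself and is continuous there) if and only if the operator $T_g\colon H^0_v\to H^0_v$ is continuous. (iv) Let $V_g\colon H^0_v\to H^0_v$ be continuous. Then $[V_g,H^0_v]=[T_g,H^0_v]$ as linear spaces in $H(\mathbb{D})$ and with equivalent norms.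
   Context: $\mathbb{D}$ is the open unit disc in $\mathbb{C}$ and $H(\mathbb{D})$ is the space of analytic functions on $\mathbb{D}$. A weight is a continuous, non-increasing function $v\colon[0,1)\to(0,\infty)$ with $\lim_{r\to1^-}v(r)=0$, extended to $\mathbb{D}$ by $v(z):=v(|z|)$. Set $H^\infty_v:=\{f\in H(\mathbb{D}): \|f\|_{\infty,v}:=\sup_{z\in\mathbb{D}}|f(z)|v(z)<\infty\}$ and $H^0_v:=\{f\in H(\mathbb{D}): \lim_{|z|\to1^-}|f(z)|v(z)=0\}$, both Banach spaces with norm $\|\cdot\|_{\infty,v}$. For $f\in H(\mathbb{D})$: $(V_gf)(z):=\int_0^zf(\xi)g'(\xi)\,d\xi$ for $z\in\mathbb{D}$; and $(T_gf)(z):=\frac1z\int_0^zf(\xi)g'(\xi)\,d\xi$ for $z\in\mathbb{D}\setminus\{0\}$, $(T_gf)(0):=f(0)g'(0)$, so that $T_gf\in H(\mathbb{D})$. For $R\in\{V_g,T_g\}$ and $X\in\{H^\infty_v,H^0_v\}$ with $R(X)\subseteq X$, the optimal domain is $[R,X]:=\{f\in H(\mathbb{D}): Rf\in X\}$ with norm $\|f\|_{[R,X]}:=\|Rf\|_{\infty,v}$. *)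

theory Defs
  imports "HOL-Complex_Analysis.Complex_Analysis"
begin

abbreviation unit_disc :: "complex set" ("\<D>")
  where "\<D> \<equiv> ball 0 1"

text \<open>
  A function on the disc is represented by its extension by zero to the whole plane. In this way
  two elements of \<open>H\<D>\<close> are equal iff they agree on \<open>\<D>\<close>, and the weighted supremum norm below
  separates points.
\<close>
definition H\<D> :: "(complex \<Rightarrow> complex) set"
  where "H\<D> = {f. f holomorphic_on \<D> \<and> (\<forall>z. z \<notin> \<D> \<longrightarrow> f z = 0)}"

definition weight :: "(real \<Rightarrow> real) \<Rightarrow> bool"
  where "weight v \<longleftrightarrow> continuous_on {0..<1} v \<and> antimono_on {0..<1} v \<and>
           (\<forall>r\<in>{0..<1}. 0 < v r) \<and> (v \<longlongrightarrow> 0) (at_left 1)"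

text \<open>The supremum is taken in \<open>[0,\<infinity>]\<close>, so that it always exists.\<close>
definition wsup :: "(real \<Rightarrow> real) \<Rightarrow> (complex \<Rightarrow> complex) \<Rightarrow> ennreal"
  where "wsup v f = (SUP z\<in>\<D>. ennreal (norm (f z) * v (norm z)))"

definition wnorm :: "(real \<Rightarrow> real) \<Rightarrow> (complex \<Rightarrow> complex) \<Rightarrow> real"
  where "wnorm v f = enn2real (wsup v f)"

definition H_inf :: "(real \<Rightarrow> real) \<Rightarrow> (complex \<Rightarrow> complex) set"
  where "H_inf v = {f \<in> H\<D>. wsup v f < \<infinity>}"

text \<open>The filter below is \<open>|z| \<rightarrow> 1-\<close> for complex \<open>z\<close>.\<close>
definition H_0 :: "(real \<Rightarrow> real) \<Rightarrow> (complex \<Rightarrow> complex) set"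
  where "H_0 v = {f \<in> H\<D>. ((\<lambda>z. norm (f z) * v (norm z)) \<longlongrightarrow> 0) (filtercomap norm (at_left 1))}"

definition wdist :: "(real \<Rightarrow> real) \<Rightarrow> (complex \<Rightarrow> complex) \<Rightarrow> (complex \<Rightarrow> complex) \<Rightarrow> real"
  where "wdist v f h = wnorm v (\<lambda>z. f z - h z)"

definition V :: "(complex \<Rightarrow> complex) \<Rightarrow> (complex \<Rightarrow> complex) \<Rightarrow> complex \<Rightarrow> complex"
  where "V g f z = (if z \<in> \<D> then contour_integral (linepath 0 z) (\<lambda>\<xi>. f \<xi> * deriv g \<xi>) else 0)"

definition T :: "(complex \<Rightarrow> complex) \<Rightarrow> (complex \<Rightarrow> complex) \<Rightarrow> complex \<Rightarrow> complex"
  where "T g f z =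
           (if z = 0 then f 0 * deriv g 0
            else if z \<in> \<D> then 1 / z * contour_integral (linepath 0 z) (\<lambda>\<xi>. f \<xi> * deriv g \<xi>)
            else 0)"

text \<open>
  Norm continuity of \<open>R : X \<rightarrow> X\<close>; as the carrier of the topology is \<open>X\<close>, this includes
  \<open>R ` X \<subseteq> X\<close>.
\<close>
definition continuous_operator ::
    "(real \<Rightarrow> real) \<Rightarrow> (complex \<Rightarrow> complex) set \<Rightarrow> ((complex \<Rightarrow> complex) \<Rightarrow> complex \<Rightarrow> complex) \<Rightarrow> bool"
  where "continuous_operator v X R \<longleftrightarrow>
           continuous_map (Metric_space.mtopology X (wdist v)) (Metric_space.mtopology X (wdist v)) R"

definition opt_domain ::
    "((complex \<Rightarrow> complex) \<Rightarrow> complex \<Rightarrow> complex) \<Rightarrow> (complex \<Rightarrow> complex) set \<Rightarrow> (complex \<Rightarrow> complex) set"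
  where "opt_domain R X = {f \<in> H\<D>. R f \<in> X}"

definition opt_norm ::
    "(real \<Rightarrow> real) \<Rightarrow> ((complex \<Rightarrow> complex) \<Rightarrow> complex \<Rightarrow> complex) \<Rightarrow> (complex \<Rightarrow> complex) \<Rightarrow> real"
  where "opt_norm v R f = wnorm v (R f)"

definition equivalent_norms_on ::
    "(complex \<Rightarrow> complex) set \<Rightarrow> ((complex \<Rightarrow> complex) \<Rightarrow> real) \<Rightarrow> ((complex \<Rightarrow> complex) \<Rightarrow> real) \<Rightarrow> bool"
  where "equivalent_norms_on X N N' \<longleftrightarrow>
           (\<exists>c>0. \<exists>C>0. \<forall>f\<in>X. c * N f \<le> N' f \<and> N' f \<le> C * N f)"


text \<open>
  \<open>Metric_space.mtopology\<close> is meaningful only when \<open>Metric_space\<close> holds; the following facts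
  establish this for both spaces.
\<close>

lemma wsup_triangle:
  assumes "weight v"
  shows "wsup v (\<lambda>z. f z - h z) \<le> wsup v (\<lambda>z. f z - k z) + wsup v (\<lambda>z. k z - h z)"
  unfolding wsup_def
proof (rule SUP_least)
  fix z :: complex assume z: "z \<in> \<D>"
  have v: "0 < v (norm z)" using assms z by (auto simp: weight_def)
  have "norm (f z - h z) \<le> norm (f z - k z) + norm (k z - h z)"
    using norm_triangle_ineq[of "f z - k z" "k z - h z"] by simp
  then have "norm (f z - h z) * v (norm z)
      \<le> norm (f z - k z) * v (norm z) + norm (k z - h z) * v (norm z)"
    using v by (simp flip: distrib_right)
  then have "ennreal (norm (f z - h z) * v (norm z))
      \<le> ennreal (norm (f z - k z) * v (norm z)) + ennreal (norm (k z - h z) * v (norm z))"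
    using v by (simp flip: ennreal_plus add: ennreal_leI)
  also have "\<dots> \<le> (SUP z\<in>\<D>. ennreal (norm (f z - k z) * v (norm z)))
      + (SUP z\<in>\<D>. ennreal (norm (k z - h z) * v (norm z)))"
    using z by (intro add_mono SUP_upper)
  finally show "ennreal (norm (f z - h z) * v (norm z)) \<le> \<dots>" .
qed

lemma wsup_commute: "wsup v (\<lambda>z. f z - h z) = wsup v (\<lambda>z. h z - f z)"
  by (simp add: wsup_def norm_minus_commute)

lemma wsup_diff_finite:
  assumes "weight v" "f \<in> H_inf v" "h \<in> H_inf v"
  shows "wsup v (\<lambda>z. f z - h z) < \<infinity>"
proof -
  have "wsup v (\<lambda>z. f z - h z) \<le> wsup v (\<lambda>z. f z - 0) + wsup v (\<lambda>z. 0 - h z)"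
    by (rule wsup_triangle[OF assms(1)])
  also have "\<dots> < \<infinity>"
    using assms(2,3) wsup_commute[of v "\<lambda>z. 0" h] by (simp add: H_inf_def)
  finally show ?thesis .
qed

lemma Metric_space_H_inf:
  assumes "weight v"
  shows "Metric_space (H_inf v) (wdist v)"
proof
  fix f h k
  show "0 \<le> wdist v f h" by (simp add: wdist_def wnorm_def)
  show "wdist v f h = wdist v h f" by (simp add: wdist_def wnorm_def wsup_commute[of v f])
  assume f: "f \<in> H_inf v" and h: "h \<in> H_inf v"
  show "wdist v f h = 0 \<longleftrightarrow> f = h"
  proof
    assume "wdist v f h = 0"
    then have 0: "wsup v (\<lambda>z. f z - h z) = 0"
      using wsup_diff_finite[OF assms f h] by (auto simp: wdist_def wnorm_def enn2real_eq_0_iff)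
    show "f = h"
    proof
      fix z
      show "f z = h z"
      proof (cases "z \<in> \<D>")
        case True
        have "ennreal (norm (f z - h z) * v (norm z)) \<le> 0"
          unfolding 0[symmetric] wsup_def using True by (intro SUP_upper)
        moreover have "0 < v (norm z)" using assms True by (auto simp: weight_def)
        ultimately show ?thesis by (simp add: ennreal_eq_0_iff mult_le_0_iff)
      qed (use f h in \<open>auto simp: H_inf_def H\<D>_def\<close>)
    qed
  qed (simp add: wdist_def wnorm_def wsup_def)
  assume k: "k \<in> H_inf v"
  have "wsup v (\<lambda>z. f z - k z) \<le> wsup v (\<lambda>z. f z - h z) + wsup v (\<lambda>z. h z - k z)"
    by (rule wsup_triangle[OF assms])
  then show "wdist v f k \<le> wdist v f h + wdist v h k"
    using wsup_diff_finite[OF assms f h] wsup_diff_finite[OF assms h k]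
    by (simp add: wdist_def wnorm_def enn2real_mono flip: enn2real_plus)
qed

lemma H_0_subset_H_inf:
  assumes "weight v"
  shows "H_0 v \<subseteq> H_inf v"
proof
  fix f assume f: "f \<in> H_0 v"
  then have hol: "f holomorphic_on \<D>" and "f \<in> H\<D>" by (auto simp: H_0_def H\<D>_def)
  have "\<forall>\<^sub>F z in filtercomap norm (at_left (1::real)). norm (f z) * v (norm z) < 1"
    using f by (intro order_tendstoD(2)[of _ 0]) (auto simp: H_0_def)
  then obtain b where b: "b < 1" "\<And>z. b < norm z \<Longrightarrow> norm z < 1 \<Longrightarrow> norm (f z) * v (norm z) < 1"
    unfolding eventually_filtercomap eventually_at_left_field by blast
  have "continuous_on (cball 0 b) (\<lambda>z. norm (f z) * v (norm z))"
  proof (intro continuous_intros)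
    show "continuous_on (cball 0 b) f"
      by (rule continuous_on_subset[OF holomorphic_on_imp_continuous_on[OF hol]]) (use b in auto)
    show "continuous_on (cball (0::complex) b) (\<lambda>z. v (norm z))"
      by (rule continuous_on_compose2[of "{0..<1}" v])
         (use assms b in \<open>auto simp: weight_def intro!: continuous_intros\<close>)
  qed
  then have "bounded ((\<lambda>z. norm (f z) * v (norm z)) ` cball 0 b)"
    by (intro compact_imp_bounded compact_continuous_image) auto
  then obtain B where B: "\<And>z. norm z \<le> b \<Longrightarrow> norm (f z) * v (norm z) \<le> B"
    using bounded_imp_bdd_above by (force simp: bdd_above_def)
  have "wsup v f \<le> ennreal (max B 1)"
    unfolding wsup_def
  proof (intro SUP_least ennreal_leI)
    fix z :: complex assume "z \<in> \<D>"
    then show "norm (f z) * v (norm z) \<le> max B 1"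
      using b(2)[of z] B[of z] by (cases "norm z \<le> b") auto
  qed
  also have "\<dots> < \<infinity>" by simp
  finally show "f \<in> H_inf v" using \<open>f \<in> H\<D>\<close> by (simp add: H_inf_def)
qed

lemma Metric_space_H_0:
  assumes "weight v"
  shows "Metric_space (H_0 v) (wdist v)"
  by (rule Metric_space.subspace[OF Metric_space_H_inf[OF assms] H_0_subset_H_inf[OF assms]])

end

theory Submission
  imports Defs
begin

text \<open>
  Since \<open>V g f z = z * T g f z\<close> on the whole plane, everything reduces to comparing \<open>z * h z\<close>
  with \<open>h\<close> for holomorphic \<open>h\<close>. Multiplication by \<open>z\<close> does not increase the weighted norm. For
  the converse, \<open>\<bar>h\<bar> \<le> 2 \<bar>z h\<bar>\<close> outside the disc of radius \<open>1/2\<close>; inside it, the maximum modulus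
  principle bounds \<open>\<bar>h\<bar>\<close> by its values on the circle of radius \<open>1/2\<close>, at the cost of a factor
  \<open>v 0 / v (1/2)\<close>.
\<close>

section \<open>Weighted norms and boundary limits under multiplication by \<open>z\<close>\<close>

lemma wsup_mult_id_le:
  assumes "weight v"
  shows "wsup v (\<lambda>z. z * h z) \<le> wsup v h"
  unfolding wsup_def
proof (rule SUP_mono)
  fix z :: complex assume z: "z \<in> \<D>"
  then have "0 < v (norm z)" using assms by (auto simp: weight_def)
  moreover have "norm (z * h z) \<le> norm (h z)"
    using z by (simp add: norm_mult mult_left_le_one_le)
  ultimately have "ennreal (norm (z * h z) * v (norm z)) \<le> ennreal (norm (h z) * v (norm z))"
    by (intro ennreal_leI mult_right_mono) auto
  with z show "\<exists>w\<in>\<D>. ennreal (norm (z * h z) * v (norm z)) \<le> ennreal (norm (h w) * v (norm w))"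
    by blast
qed

lemma wsup_le_mult_id:
  assumes v: "weight v" and h: "h holomorphic_on \<D>"
  shows "wsup v h \<le> ennreal (2 * v 0 / v (1/2)) * wsup v (\<lambda>z. z * h z)"
proof (cases "wsup v (\<lambda>z. z * h z)")
  case (real s)
  have pos: "0 < v r" if "0 \<le> r" "r < 1" for r
    using v that by (auto simp: weight_def)
  have anti: "v t \<le> v r" if "0 \<le> r" "r \<le> t" "t < 1" for r t
    using v that by (auto simp: weight_def monotone_on_def)
  have v0: "0 < v 0" and v2: "0 < v (1/2)" using pos by auto
  \<comment> \<open>The outer region only costs a factor 2. Since \<open>v\<close> is
    non-increasing, \<open>v 0 / v (1/2)\<close> is at least 1, so one constant serves both
    regions.\<close>
  have C: "2 \<le> 2 * v 0 / v (1/2)"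
    using anti[of 0 "1/2"] v2 by (simp add: field_simps)
  have s: "norm z * norm (h z) * v (norm z) \<le> s" if "z \<in> \<D>" for z
  proof -
    have "ennreal (norm (z * h z) * v (norm z)) \<le> ennreal s"
      unfolding real(2)[symmetric] wsup_def using that by (intro SUP_upper)
    then show ?thesis using \<open>0 \<le> s\<close> by (simp add: norm_mult ennreal_le_iff)
  qed
  \<comment> \<open>This is \<open>s\<close> solved for \<open>norm (h z)\<close> at radius
    \<open>1/2\<close>, where it reads \<open>1/2 * norm (h z) * v (1/2) \<le> s\<close>.\<close>
  have circle: "norm (h z) \<le> 2 * s / v (1/2)" if "norm z = 1/2" for z
    using s[of z] that v2 by (simp add: field_simps)
  have inner: "norm (h z) \<le> 2 * s / v (1/2)" if "norm z \<le> 1/2" for z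
  proof (rule maximum_modulus_frontier[of h "cball 0 (1/2)"])
    show "h holomorphic_on interior (cball 0 (1/2))"
      by (rule holomorphic_on_subset[OF h]) auto
    have "h holomorphic_on cball 0 (1/2)"
      by (rule holomorphic_on_subset[OF h]) auto
    then show "continuous_on (closure (cball 0 (1/2))) h"
      by (simp add: holomorphic_on_imp_continuous_on)
  qed (use that circle in auto)
  have "wsup v h \<le> ennreal (2 * v 0 / v (1/2) * s)"
    unfolding wsup_def
  proof (intro SUP_least ennreal_leI)
    fix z :: complex assume z: "z \<in> \<D>"
    then have vz: "0 < v (norm z)" using pos by simp
    show "norm (h z) * v (norm z) \<le> 2 * v 0 / v (1/2) * s"
    proof (cases "norm z \<le> 1/2")
      case True
      \<comment> \<open>The weight at \<open>z\<close> is bounded by its largest value,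
        \<open>v 0\<close>; this is the source of the numerator of the constant.\<close>
      have "norm (h z) * v (norm z) \<le> 2 * s / v (1/2) * v 0"
        using inner[OF True] anti[of 0 "norm z"] vz z \<open>0 \<le> s\<close> v2 by (intro mult_mono) auto
      then show ?thesis by (simp add: ac_simps)
    next
      case False
      have "1/2 * (norm (h z) * v (norm z)) \<le> norm z * (norm (h z) * v (norm z))"
        using False vz by (intro mult_right_mono) auto
      then have "norm (h z) * v (norm z) \<le> 2 * s" using s[OF z] by (simp add: ac_simps)
      also have "\<dots> \<le> 2 * v 0 / v (1/2) * s" by (rule mult_right_mono[OF C \<open>0 \<le> s\<close>])
      finally show ?thesis .
    qed
  qed
  also have "\<dots> = ennreal (2 * v 0 / v (1/2)) * wsup v (\<lambda>z. z * h z)"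
    unfolding real(2) using C \<open>0 \<le> s\<close> by (intro ennreal_mult) auto
  finally show ?thesis .
next
  case top
  have "0 < v 0" "0 < v (1/2)" using v by (auto simp: weight_def)
  then show ?thesis by (simp add: top ennreal_mult_top)
qed

text \<open>The two suprema bound each other up to a finite factor. Besides membership in
  \<open>H_inf v\<close>, this is what allows passing to real norms: \<open>enn2real\<close> sends
  infinity to 0, so an inequality in [0,\<infinity>] survives only if the larger side is
  finite.\<close>

lemma wsup_mult_id_less_top_iff:
  assumes "weight v" and "h holomorphic_on \<D>"
  shows "wsup v (\<lambda>z. z * h z) < \<infinity> \<longleftrightarrow> wsup v h < \<infinity>"
proof
  assume "wsup v (\<lambda>z. z * h z) < \<infinity>"
  then have "ennreal (2 * v 0 / v (1/2)) * wsup v (\<lambda>z. z * h z) < \<infinity>"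
    by (simp add: ennreal_mult_less_top)
  with wsup_le_mult_id[OF assms] show "wsup v h < \<infinity>" by (rule order.strict_trans1)
qed (rule order.strict_trans1[OF wsup_mult_id_le[OF assms(1)]])

lemma wnorm_mult_id_le:
  assumes "weight v" and "h holomorphic_on \<D>"
  shows "wnorm v (\<lambda>z. z * h z) \<le> wnorm v h"
proof (cases "wsup v h < \<infinity>")
  case True
  then show ?thesis using wsup_mult_id_le[OF assms(1), of h] by (simp add: wnorm_def enn2real_mono)
next
  \<comment> \<open>Here both suprema are infinite, so the left-hand norm takes the default value
    0.\<close>
  case False
  then have "\<not> wsup v (\<lambda>z. z * h z) < \<infinity>" using wsup_mult_id_less_top_iff[OF assms] by simp
  then show ?thesis by (simp add: wnorm_def less_top[symmetric])
qed

lemma wnorm_le_mult_id: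
  assumes "weight v" and "h holomorphic_on \<D>"
  shows "wnorm v h \<le> 2 * v 0 / v (1/2) * wnorm v (\<lambda>z. z * h z)"
proof -
  have C: "0 \<le> 2 * v 0 / v (1/2)" using assms(1) by (auto simp: weight_def intro: less_imp_le)
  show ?thesis
  proof (cases "wsup v h < \<infinity>")
    case True
    then have "wsup v (\<lambda>z. z * h z) < \<infinity>" using wsup_mult_id_less_top_iff[OF assms] by simp
    then have "enn2real (wsup v h) \<le> enn2real (ennreal (2 * v 0 / v (1/2)) * wsup v (\<lambda>z. z * h z))"
      by (intro enn2real_mono wsup_le_mult_id[OF assms]) (simp add: ennreal_mult_less_top)
    then show ?thesis using C by (simp add: wnorm_def enn2real_mult)
  next
    case False
    then have "wnorm v h = 0" by (simp add: wnorm_def less_top[symmetric])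
    then show ?thesis using mult_nonneg_nonneg[OF C] by (simp add: wnorm_def)
  qed
qed

text \<open>Only points near the unit circle matter. For \<open>1/2 < norm z < 1\<close> the two
  expressions differ by the factor \<open>norm z\<close>, which lies between \<open>1/2\<close> and
  1, so each tends to 0 by comparison with the other.\<close>

lemma tendsto_mult_id_iff:
  fixes v :: "real \<Rightarrow> real" and h :: "complex \<Rightarrow> complex"
  shows "((\<lambda>z. norm (z * h z) * v (norm z)) \<longlongrightarrow> 0) (filtercomap norm (at_left 1)) \<longleftrightarrow>
    ((\<lambda>z. norm (h z) * v (norm z)) \<longlongrightarrow> 0) (filtercomap norm (at_left 1))"
    (is "(?f \<longlongrightarrow> 0) ?F \<longleftrightarrow> (?g \<longlongrightarrow> 0) ?F")
proof
  have ev: "\<forall>\<^sub>F z in ?F. 1/2 < norm z \<and> norm z < 1"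
    using eventually_at_left_real[of "1/2" "1::real"]
    by (intro eventually_filtercomapI) (auto elim: eventually_mono)
  show "(?g \<longlongrightarrow> 0) ?F" if "(?f \<longlongrightarrow> 0) ?F"
  proof (rule Lim_null_comparison[OF _ tendsto_mult_right_zero[OF tendsto_norm_zero[OF that], of 2]])
    show "\<forall>\<^sub>F z in ?F. norm (?g z) \<le> 2 * norm (?f z)"
      using ev
    proof eventually_elim
      case (elim z)
      have "1/2 * (norm (h z) * \<bar>v (norm z)\<bar>) \<le> norm z * (norm (h z) * \<bar>v (norm z)\<bar>)"
        using elim by (intro mult_right_mono) auto
      then show ?case by (simp add: norm_mult abs_mult ac_simps)
    qed
  qed
  show "(?f \<longlongrightarrow> 0) ?F" if "(?g \<longlongrightarrow> 0) ?F"
  proof (rule Lim_null_comparison[OF _ tendsto_norm_zero[OF that]])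
    show "\<forall>\<^sub>F z in ?F. norm (?f z) \<le> norm (?g z)"
      using ev
    proof eventually_elim
      case (elim z)
      have "norm z * (norm (h z) * \<bar>v (norm z)\<bar>) \<le> 1 * (norm (h z) * \<bar>v (norm z)\<bar>)"
        using elim by (intro mult_right_mono) auto
      then show ?case by (simp add: norm_mult abs_mult ac_simps)
    qed
  qed
qed

section \<open>The link between the two operators, and analyticity of their values\<close>

text \<open>At 0 the path is constant and off the disc both operators give 0, so the identity holds
  everywhere and can be used as an equation of functions.\<close>

lemma V_eq_mult_T: "V g f z = z * T g f z"
  by (auto simp: V_def T_def)

text \<open>On the convex disc the integrand has a primitive \<open>F\<close>, and
  \<open>T g f\<close> is the difference quotient of \<open>F\<close> at 0. Its singularity there is
  removable, with value \<open>deriv F 0 = f 0 * deriv g 0\<close>, exactly the value prescribed for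
  \<open>T g f 0\<close>.\<close>

lemma T_in_HD:
  assumes "g \<in> H\<D>" and "f \<in> H\<D>"
  shows "T g f \<in> H\<D>"
proof -
  have "(\<lambda>\<xi>. f \<xi> * deriv g \<xi>) holomorphic_on \<D>"
    using assms by (auto simp: H\<D>_def intro!: holomorphic_intros)
  then obtain F where F: "\<And>z. z \<in> \<D> \<Longrightarrow> (F has_field_derivative f z * deriv g z) (at z within \<D>)"
    using holomorphic_convex_primitive'[OF convex_ball open_ball] by blast
  have F': "(F has_field_derivative f z * deriv g z) (at z)" if "z \<in> \<D>" for z
    using F[OF that] at_within_open[OF that] by auto
  have "F holomorphic_on \<D>" 
    unfolding holomorphic_on_def field_differentiable_def using F by blast
  then have "(\<lambda>z. if z = 0 then deriv F 0 else (F z - F 0) / (z - 0)) holomorphic_on \<D>"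
    by (rule pole_lemma) auto
  moreover have "T g f z = (if z = 0 then deriv F 0 else (F z - F 0) / (z - 0))" if "z \<in> \<D>" for z
  proof (cases "z = 0")
    case True
    then show ?thesis using DERIV_imp_deriv[OF F'[of 0]] by (simp add: T_def)
  next
    case False
    have "path_image (linepath 0 z) \<subseteq> \<D>"
      using that by (simp add: closed_segment_subset)
    then have "((\<lambda>\<xi>. f \<xi> * deriv g \<xi>) has_contour_integral (F z - F 0)) (linepath 0 z)"
      using contour_integral_primitive[of \<D> F, OF F valid_path_linepath] by simp
    then show ?thesis using False that by (simp add: T_def contour_integral_unique)
  qed
  ultimately have "T g f holomorphic_on \<D>"
    by (rule holomorphic_transform[OF _ sym])
  then show ?thesis by (auto simp: H\<D>_def T_def)
qed

lemma V_in_HD: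
  assumes "g \<in> H\<D>" and "f \<in> H\<D>"
  shows "V g f \<in> H\<D>"
proof -
  have "(\<lambda>z. z * T g f z) holomorphic_on \<D>"
    using T_in_HD[OF assms] by (auto simp: H\<D>_def intro!: holomorphic_intros)
  then have "V g f holomorphic_on \<D>" by (simp add: V_eq_mult_T[abs_def])
  then show ?thesis by (simp add: H\<D>_def V_def)
qed

section \<open>From norm bounds to continuity, optimal domains and equivalent norms\<close>

text \<open>Distances between values of \<open>B\<close> are at most \<open>C\<close> times those
  between values of \<open>A\<close>, so a \<delta> that serves \<open>A\<close> for
  \<open>\<epsilon> / C\<close> serves \<open>B\<close> for \<epsilon>. Invariance of
  \<open>X\<close> under \<open>A\<close> is part of the continuity of \<open>A\<close>, and
  \<open>maps\<close> carries it over to \<open>B\<close>.\<close>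

lemma continuous_map_metric_transfer:
  fixes d :: "'a \<Rightarrow> 'a \<Rightarrow> real"
  assumes "Metric_space X d"
    and A: "continuous_map (Metric_space.mtopology X d) (Metric_space.mtopology X d) A"
    and maps: "\<And>x. x \<in> X \<Longrightarrow> A x \<in> X \<Longrightarrow> B x \<in> X"
    and "0 < C" and le: "\<And>x y. x \<in> X \<Longrightarrow> y \<in> X \<Longrightarrow> d (B x) (B y) \<le> C * d (A x) (A y)"
  shows "continuous_map (Metric_space.mtopology X d) (Metric_space.mtopology X d) B"
proof -
  interpret Metric_space X d by fact
  note metric = metric_continuous_map[OF Metric_space_axioms]
  have AX: "A ` X \<subseteq> X"
    and lim: "\<And>a \<epsilon>. a \<in> X \<Longrightarrow> 0 < \<epsilon> \<Longrightarrow> \<exists>\<delta>>0. \<forall>x. x \<in> X \<and> d a x < \<delta> \<longrightarrow> d (A a) (A x) < \<epsilon>"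
    using A unfolding metric by auto
  show ?thesis
    unfolding metric
  proof (intro conjI ballI allI impI)
    show "B ` X \<subseteq> X" using AX maps by auto
    fix a and \<epsilon> :: real assume a: "a \<in> X" and "0 < \<epsilon>"
    then obtain \<delta> where "0 < \<delta>" and \<delta>: "\<And>x. x \<in> X \<Longrightarrow> d a x < \<delta> \<Longrightarrow> d (A a) (A x) < \<epsilon> / C"
      using lim[of a "\<epsilon> / C"] \<open>0 < C\<close> by auto
    have "d (B a) (B x) < \<epsilon>" if "x \<in> X" "d a x < \<delta>" for x
      using le[OF a that(1)] \<delta>[OF that] \<open>0 < C\<close> by (simp add: field_simps)
    with \<open>0 < \<delta>\<close> show "\<exists>\<delta>>0. \<forall>x. x \<in> X \<and> d a x < \<delta> \<longrightarrow> d (B a) (B x) < \<epsilon>" by blast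
  qed
qed

lemma V_in_H_inf_iff:
  assumes "weight v" and "g \<in> H\<D>" and "f \<in> H\<D>"
  shows "V g f \<in> H_inf v \<longleftrightarrow> T g f \<in> H_inf v"
proof -
  have "wsup v (V g f) < \<infinity> \<longleftrightarrow> wsup v (T g f) < \<infinity>"
    using wsup_mult_id_less_top_iff[OF assms(1), of "T g f"] T_in_HD[OF assms(2,3)]
    by (simp add: H\<D>_def V_eq_mult_T[abs_def])
  then show ?thesis using T_in_HD[OF assms(2,3)] V_in_HD[OF assms(2,3)] by (simp add: H_inf_def)
qed

lemma V_in_H_0_iff:
  assumes "g \<in> H\<D>" and "f \<in> H\<D>"
  shows "V g f \<in> H_0 v \<longleftrightarrow> T g f \<in> H_0 v"
  using T_in_HD[OF assms] V_in_HD[OF assms] tendsto_mult_id_iff[of "T g f" v]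
  by (simp add: H_0_def V_eq_mult_T[abs_def])

lemma wnorm_V_le_T:
  assumes "weight v" and "g \<in> H\<D>" and "f \<in> H\<D>"
  shows "wnorm v (V g f) \<le> wnorm v (T g f)"
  using wnorm_mult_id_le[OF assms(1), of "T g f"] T_in_HD[OF assms(2,3)]
  by (simp add: H\<D>_def V_eq_mult_T[abs_def])

lemma wnorm_T_le_V:
  assumes "weight v" and "g \<in> H\<D>" and "f \<in> H\<D>"
  shows "wnorm v (T g f) \<le> 2 * v 0 / v (1/2) * wnorm v (V g f)"
  using wnorm_le_mult_id[OF assms(1), of "T g f"] T_in_HD[OF assms(2,3)]
  by (simp add: H\<D>_def V_eq_mult_T[abs_def])

lemma
  assumes "weight v" and "g \<in> H\<D>" and "f \<in> H\<D>" and "h \<in> H\<D>"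
  shows wdist_V_le_T: "wdist v (V g f) (V g h) \<le> wdist v (T g f) (T g h)"
    and wdist_T_le_V: "wdist v (T g f) (T g h) \<le> 2 * v 0 / v (1/2) * wdist v (V g f) (V g h)"
proof -
  \<comment> \<open>Multiplying this difference by \<open>z\<close> gives
    \<open>V g f z - V g h z\<close>, so the norm comparison applies to it directly, with no appeal
    to linearity of the operators.\<close>
  have "(\<lambda>z. T g f z - T g h z) holomorphic_on \<D>"
    using T_in_HD[OF assms(2,3)] T_in_HD[OF assms(2,4)]
    by (auto simp: H\<D>_def intro!: holomorphic_intros)
  from wnorm_mult_id_le[OF assms(1) this] wnorm_le_mult_id[OF assms(1) this]
  show "wdist v (V g f) (V g h) \<le> wdist v (T g f) (T g h)"
    and "wdist v (T g f) (T g h) \<le> 2 * v 0 / v (1/2) * wdist v (V g f) (V g h)"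
    by (simp_all add: wdist_def V_eq_mult_T right_diff_distrib)
qed

text \<open>With \<open>X\<close> left abstract, one argument covers both \<open>H_inf v\<close> and
  \<open>H_0 v\<close>. The equivalence \<open>iff\<close> ranges over all of \<open>H\<D>\<close>,
  since optimal domains may contain functions outside \<open>X\<close>.\<close>

lemma V_T_comparison:
  assumes v: "weight v" and g: "g \<in> H\<D>"
    and X: "Metric_space X (wdist v)" "X \<subseteq> H\<D>"
    and iff: "\<And>f. f \<in> H\<D> \<Longrightarrow> V g f \<in> X \<longleftrightarrow> T g f \<in> X"
  shows "continuous_operator v X (V g) \<longleftrightarrow> continuous_operator v X (T g)"
    and "opt_domain (V g) X = opt_domain (T g) X"
    and "equivalent_norms_on (opt_domain (V g) X) (opt_norm v (V g)) (opt_norm v (T g))"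
proof -
  have C: "0 < 2 * v 0 / v (1/2)" using v by (auto simp: weight_def)
  show "continuous_operator v X (V g) \<longleftrightarrow> continuous_operator v X (T g)"
    unfolding continuous_operator_def
  proof
    let ?top = "Metric_space.mtopology X (wdist v)"
    show "continuous_map ?top ?top (T g)" if "continuous_map ?top ?top (V g)"
      by (rule continuous_map_metric_transfer[OF X(1) that _ C])
         (use X(2) iff in \<open>auto intro!: wdist_T_le_V[OF v g] simp del: times_divide_eq_left\<close>)
    show "continuous_map ?top ?top (V g)" if "continuous_map ?top ?top (T g)"
      by (rule continuous_map_metric_transfer[OF X(1) that _ zero_less_one])
         (use X(2) iff in \<open>auto intro!: wdist_V_le_T[OF v g]\<close>)
  qed
  show "opt_domain (V g) X = opt_domain (T g) X"
    using iff by (auto simp: opt_domain_def)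
  show "equivalent_norms_on (opt_domain (V g) X) (opt_norm v (V g)) (opt_norm v (T g))"
    unfolding equivalent_norms_on_def
    using wnorm_V_le_T[OF v g] wnorm_T_le_V[OF v g] C
    \<comment> \<open>The lower constant 1 reflects that multiplication by \<open>z\<close> is a
      contraction; the upper one is the cost of dividing by \<open>z\<close>.\<close>
    by (intro exI[of _ 1] exI[of _ "2 * v 0 / v (1/2)"] conjI) (auto simp: opt_domain_def opt_norm_def)
qed

theorem proposition5p3:
  fixes v :: "real \<Rightarrow> real" and g :: "complex \<Rightarrow> complex"
  assumes "weight v" and "g \<in> H\<D>" and "\<not> g constant_on \<D>"
  shows "(continuous_operator v (H_inf v) (V g) \<longleftrightarrow> continuous_operator v (H_inf v) (T g)) \<and>
    (continuous_operator v (H_inf v) (V g) \<longrightarrow>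
       opt_domain (V g) (H_inf v) = opt_domain (T g) (H_inf v) \<and>
       equivalent_norms_on (opt_domain (V g) (H_inf v)) (opt_norm v (V g)) (opt_norm v (T g))) \<and>
    (continuous_operator v (H_0 v) (V g) \<longleftrightarrow> continuous_operator v (H_0 v) (T g)) \<and>
    (continuous_operator v (H_0 v) (V g) \<longrightarrow>
       opt_domain (V g) (H_0 v) = opt_domain (T g) (H_0 v) \<and>
       equivalent_norms_on (opt_domain (V g) (H_0 v)) (opt_norm v (V g)) (opt_norm v (T g)))"
proof -
  note inf = V_T_comparison[OF assms(1,2) Metric_space_H_inf[OF assms(1)] _ V_in_H_inf_iff[OF assms(1,2)]]
  note zero = V_T_comparison[OF assms(1,2) Metric_space_H_0[OF assms(1)] _ V_in_H_0_iff[OF assms(2)]]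
  have "H_inf v \<subseteq> H\<D>" "H_0 v \<subseteq> H\<D>" by (auto simp: H_inf_def H_0_def)
  then show ?thesis using inf zero by blast
qed

end
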